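(* Let $\tau$ be a topology on $X$. Let $\beta\ge 0$, $y\in Y$, and let $F\colon X\to Y$ be a mapping; let $(\beta_k)_{k\in\mathbb N}$ be a sequence of nonnegative numbers, $(y_k)_{k\in\mathbb N}$ a sequence in $Y$, and $(F_k)_{k\in\mathbb N}$ a sequence of mappings $F_k\colon X\to Y$. Assume that $\beta_k\to\beta$, that $(y_k)$ converges $\mathcal S$-uniformly to $y$, and that $(F_k)$ converges locally $\mathcal S$-uniformly to $F$. Assume that the sets $\Phi_{\mathcal R}(F_k,w,\gamma,t)$ and $\Phi_{\mathcal R}(F,w,\gamma,t)$ are $\tau$-compact for all $w\in Y$, $\gamma\ge 0$, $t\ge 0$ and $k\in\mathbb N$, and that for every $w\in Y$, $\gamma\ge 0$, $k\in\mathbb N$ there exists some $t_0$ such that $\Phi_{\mathcal R}(F_k,w,\gamma,t_0)$ and $\Phi_{\mathcal R}(F,w,\gamma,t_0)$ are non-empty. Assume moreover that \[ \limsup_{k\to\infty} v(F_k,y_k,\beta_k)\le v(F,y,\beta)<\infty . \] Then \[ \emptyset\neq \tau_{\mathcal R}\text{-}\limsup_{k\to\infty}\Sigma(F_k,y_k,\beta_k)\subset \Sigma(F,y,\beta). \] If, additionally, the set $\Sigma(F,y,\beta)$ consists of a single element $x_\beta$, then \[ \{x_\beta\}=\tau_{\mathcal R}\text{-}\lim_{k\to\infty}\Sigma(F_k,y_k,\beta_k). \]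
   Context: $X$ and $Y$ are sets, $\mathcal R\colon X\to[0,+\infty]$ is a functional, and $\mathcal S\colon Y\times Y\to[0,+\infty]$ is a functional with $\mathcal S(y,z)=0$ if and only if $y=z$. For a mapping $G\colon X\to Y$, $w\in Y$ and real $\gamma$, $t$ (with $\inf\emptyset=+\infty$): \[ \Phi(G,w,\gamma):=\{x\in X:\mathcal S(G(x),w)\le\gamma\},\quad v(G,w,\gamma):=\inf\{\mathcal R(x):x\in\Phi(G,w,\gamma)\}, \] \[ \Sigma(G,w,\gamma):=\{x\in\Phi(G,w,\gamma):\mathcal R(x)=v(G,w,\gamma)\},\quad \Phi_{\mathcal R}(G,w,\gamma,t):=\Phi(G,w,\gamma)\cap\{x\in X:\mathcal R(x)\le t\}. \] $(y_k)$ converges $\mathcal S$-uniformly to $y$ if $\sup\{|\mathcal S(z,y_k)-\mathcal S(z,y)|:z\in Y\}\to0$. $(F_k)$ converges locally $\mathcal S$-uniformly to $F$ if for every $t\ge0$, $\sup\{|\mathcal S(F_k(x),z)-\mathcal S(F(x),z)|:z\in Y,\ x\in X,\ \mathcal R(x)\le t\}\to0$. The topology $\tau_{\mathcal R}$ on $X$ is the one generated by all sets $U\cap\{x\in X:\mathcal R(x)>s\}$ with $U\in\tau$, $s\in\mathbb R$, and all sets $U\cap\{x\in X:\mathcal R(x)<t\}$ with $U\in\tau$, $t\in\mathbb R\cup\{\infty\}$. For a topology $\sigma$ on $X$ and a sequence $(\Sigma_k)$ of subsets of $X$: the upper limit is $\sigma\text{-}\limsup_{k}\Sigma_k:=\bigcap_{k\in\mathbb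 N}\operatorname{cl}_\sigma\bigl(\bigcup_{k'\ge k}\Sigma_{k'}\bigr)$; the lower limit $\sigma\text{-}\liminf_k\Sigma_k$ is the set of all $x\in X$ such that for every $\sigma$-neighborhood $N$ of $x$ there is $k_0$ with $N\cap\Sigma_k\ne\emptyset$ for all $k\ge k_0$; if the two coincide, their common value is the limit $\sigma\text{-}\lim_k\Sigma_k$ (an equation involving this limit includes the assertion that it exists).
   Formalization: The sets Φ_R(F_k,w,γ,t) and Φ_R(F,w,γ,t) are assumed τ-closed as well as τ-compact (automatic if τ is Hausdorff); for arbitrary τ the claim fails, e.g. X=ℕ indiscrete, R(n)=1/(n+1), Y a point, where all Σ are empty. *)

theory Defs
  imports "HOL-Analysis.Analysis"
begin

text \<open>
  The sets \<open>X\<close> and \<open>Y\<close> are the types \<open>'x\<close> and \<open>'y\<close>. The functionals \<open>R\<close> and \<open>S\<close> take values in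
  \<^typ>\<open>ennreal\<close>, where \<open>Inf {} = \<top>\<close> and \<open>Sup {} = 0\<close>. Comparisons with a real number go through
  \<^typ>\<open>ereal\<close>, because the coercion \<^const>\<open>ennreal\<close> sends negative reals to 0.

  Compactness of the sets \<open>PhiR\<close> is always required together with closedness: this is automatic in a
  Hausdorff space, but in a general topological space the nested sets \<open>PhiR R S G w \<gamma> t\<close> need not
  have a common point (take the indiscrete topology, where every set is compact).
\<close>

definition Phi :: "('y \<Rightarrow> 'y \<Rightarrow> ennreal) \<Rightarrow> ('x \<Rightarrow> 'y) \<Rightarrow> 'y \<Rightarrow> real \<Rightarrow> 'x set" where
  "Phi S G w \<gamma> = {x. enn2ereal (S (G x) w) \<le> ereal \<gamma>}"

definition val :: "('x \<Rightarrow> ennreal) \<Rightarrow> ('y \<Rightarrow> 'y \<Rightarrow> ennreal) \<Rightarrow> ('x \<Rightarrow> 'y) \<Rightarrow> 'y \<Rightarrow> real \<Rightarrow> ennreal" where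
  "val R S G w \<gamma> = (INF x\<in>Phi S G w \<gamma>. R x)"

definition Sol :: "('x \<Rightarrow> ennreal) \<Rightarrow> ('y \<Rightarrow> 'y \<Rightarrow> ennreal) \<Rightarrow> ('x \<Rightarrow> 'y) \<Rightarrow> 'y \<Rightarrow> real \<Rightarrow> 'x set" where
  "Sol R S G w \<gamma> = {x \<in> Phi S G w \<gamma>. R x = val R S G w \<gamma>}"

definition PhiR ::
  "('x \<Rightarrow> ennreal) \<Rightarrow> ('y \<Rightarrow> 'y \<Rightarrow> ennreal) \<Rightarrow> ('x \<Rightarrow> 'y) \<Rightarrow> 'y \<Rightarrow> real \<Rightarrow> real \<Rightarrow> 'x set" where
  "PhiR R S G w \<gamma> t = Phi S G w \<gamma> \<inter> {x. enn2ereal (R x) \<le> ereal t}"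

text \<open>
  The quantity \<open>\<bar>a - b\<bar>\<close> on \<open>[0, \<infinity>]\<close>, with \<open>\<bar>\<infinity> - \<infinity>\<bar> = 0\<close>. Subtraction on \<^typ>\<open>ennreal\<close>
  is truncated at 0 and satisfies \<open>\<top> - \<top> = \<top>\<close>, hence the explicit case \<open>a = b\<close>.
\<close>
definition absdiff :: "ennreal \<Rightarrow> ennreal \<Rightarrow> ennreal" where
  "absdiff a b = (if a = b then 0 else max (a - b) (b - a))"

definition S_uniform_conv :: "('y \<Rightarrow> 'y \<Rightarrow> ennreal) \<Rightarrow> (nat \<Rightarrow> 'y) \<Rightarrow> 'y \<Rightarrow> bool" where
  "S_uniform_conv S yk y \<longleftrightarrow> (\<lambda>k. SUP z. absdiff (S z (yk k)) (S z y)) \<longlonglongrightarrow> 0"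

definition loc_S_uniform_conv ::
  "('x \<Rightarrow> ennreal) \<Rightarrow> ('y \<Rightarrow> 'y \<Rightarrow> ennreal) \<Rightarrow> (nat \<Rightarrow> 'x \<Rightarrow> 'y) \<Rightarrow> ('x \<Rightarrow> 'y) \<Rightarrow> bool" where
  "loc_S_uniform_conv R S Fk F \<longleftrightarrow>
    (\<forall>t::real. 0 \<le> t \<longrightarrow>
      (\<lambda>k. Sup {absdiff (S (Fk k x) z) (S (F x) z) | x z. enn2ereal (R x) \<le> ereal t}) \<longlonglongrightarrow> 0)"

definition tauR :: "'x topology \<Rightarrow> ('x \<Rightarrow> ennreal) \<Rightarrow> 'x topology" where
  "tauR \<tau> R = topology_generated_by
    ({U \<inter> {x. ereal s < enn2ereal (R x)} | U s. openin \<tau> U} \<union>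
     {U \<inter> {x. enn2ereal (R x) < t} | U (t::ereal). openin \<tau> U \<and> t \<noteq> -\<infinity>})"

definition upper_limit :: "'x topology \<Rightarrow> (nat \<Rightarrow> 'x set) \<Rightarrow> 'x set" where
  "upper_limit \<sigma> A = (\<Inter>k. \<sigma> closure_of (\<Union>k'\<in>{k..}. A k'))"

definition lower_limit :: "'x topology \<Rightarrow> (nat \<Rightarrow> 'x set) \<Rightarrow> 'x set" where
  "lower_limit \<sigma> A = {x \<in> topspace \<sigma>. \<forall>N. (\<exists>U. openin \<sigma> U \<and> x \<in> U \<and> U \<subseteq> N) \<longrightarrow>
     (\<exists>k0. \<forall>k\<ge>k0. N \<inter> A k \<noteq> {})}"

definition set_limit :: "'x topology \<Rightarrow> (nat \<Rightarrow> 'x set) \<Rightarrow> 'x set \<Rightarrow> bool" where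
  "set_limit \<sigma> A L \<longleftrightarrow> upper_limit \<sigma> A = L \<and> lower_limit \<sigma> A = L"

end

theory Submission
  imports Defs
begin

text \<open>
  Write \<open>v = val R S F y \<beta>\<close>. Uniform convergence puts the solution sets \<open>\<Sigma>\<^sub>k\<close> of the perturbed problems
  eventually inside \<open>PhiR R S F y (\<beta> + \<epsilon>) (v + \<epsilon>)\<close>, for every \<open>\<epsilon> > 0\<close>. These sets are closed, compact
  and shrink to \<open>PhiR R S F y \<beta> v\<close>, which is the solution set of the limit problem; hence
  \<open>\<tau>\<close>-cluster points of the \<open>\<Sigma>\<^sub>k\<close> exist and are solutions. The same compactness argument shows
  that the values cannot drop below \<open>v\<close> in the limit, so they converge to \<open>v\<close>; as \<open>R\<close> is constant on each
  \<open>\<Sigma>\<^sub>k\<close>, every \<open>\<tau>\<close>-cluster point is a \<open>tauR \<tau> R\<close>-cluster point. For a single solution, apply this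
  to the subsequence of those \<open>\<Sigma>\<^sub>k\<close> that miss a given neighbourhood.
\<close>

section \<open>Membership criteria and estimates on the extended half-line\<close>

lemma enn2ereal_le_ereal_iff: "0 \<le> r \<Longrightarrow> enn2ereal u \<le> ereal r \<longleftrightarrow> u \<le> ennreal r"
  by (simp add: less_eq_ennreal.rep_eq enn2ereal_ennreal)

lemma mem_Phi: "0 \<le> \<gamma> \<Longrightarrow> x \<in> Phi S G w \<gamma> \<longleftrightarrow> S (G x) w \<le> ennreal \<gamma>"
  by (simp add: Phi_def enn2ereal_le_ereal_iff)

lemma mem_PhiR:
  "0 \<le> \<gamma> \<Longrightarrow> 0 \<le> t \<Longrightarrow>
    x \<in> PhiR R S G w \<gamma> t \<longleftrightarrow> S (G x) w \<le> ennreal \<gamma> \<and> R x \<le> ennreal t"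
  by (simp add: PhiR_def mem_Phi enn2ereal_le_ereal_iff)

lemma val_le: "x \<in> Phi S G w \<gamma> \<Longrightarrow> val R S G w \<gamma> \<le> R x"
  by (simp add: val_def INF_lower)

text \<open>On the feasible set \<open>R\<close> never goes below the optimal value, so at that
  level the bound on \<open>R\<close> is an equality. Existence of solutions thereby becomes
  non-emptiness of one \<open>PhiR\<close>.\<close>

lemma PhiR_val_eq_Sol:
  assumes "val R S G w \<gamma> = ennreal r" "0 \<le> \<gamma>" "0 \<le> r"
  shows "PhiR R S G w \<gamma> r = Sol R S G w \<gamma>"
  using assms val_le[of _ S G w \<gamma> R] by (fastforce simp: Sol_def mem_PhiR mem_Phi)

text \<open>Stands in for the triangle inequality, which \<open>S\<close> need not satisfy. It also
  holds at infinite values, so the later estimates need no finiteness of \<open>S\<close>.\<close>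

lemma le_add_absdiff: "b \<le> a + absdiff a b"
proof (cases "a = b")
  case False
  have "b \<le> a + (b - a)"
    using ennreal_minus_le_iff[of b a "b - a"] by simp
  also have "\<dots> \<le> a + absdiff a b"
    using False by (intro add_left_mono) (simp add: absdiff_def)
  finally show ?thesis .
qed simp

lemma le_ennreal_seqI:
  assumes "0 \<le> r" "\<And>n. u \<le> ennreal (r + inverse (real (Suc n)))"
  shows "u \<le> ennreal r"
proof -
  have "(\<lambda>n. ennreal (r + inverse (real (Suc n)))) \<longlonglongrightarrow> ennreal (r + 0)"
    by (intro tendsto_ennrealI tendsto_add tendsto_const LIMSEQ_inverse_real_of_nat)
  then show ?thesis
    using assms(2) by (intro LIMSEQ_le_const[where X = "\<lambda>n. ennreal (r + inverse (real (Suc n)))"]) auto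
qed

section \<open>Relaxed feasible sets and compactness\<close>

text \<open>Constraint and level are relaxed together, since the perturbed solutions may violate
  both bounds of the limit problem. The slack runs through a sequence so that the family is a nested
  countable one.\<close>

definition shrinking ::
  "('x \<Rightarrow> ennreal) \<Rightarrow> ('y \<Rightarrow> 'y \<Rightarrow> ennreal) \<Rightarrow> ('x \<Rightarrow> 'y) \<Rightarrow> 'y \<Rightarrow> real \<Rightarrow> real \<Rightarrow> nat \<Rightarrow> 'x set" where
  "shrinking R S G w \<gamma> t n =
    PhiR R S G w (\<gamma> + inverse (real (Suc n))) (t + inverse (real (Suc n)))"

lemma Inter_shrinking:
  assumes "0 \<le> \<gamma>" "0 \<le> t"
  shows "(\<Inter>n. shrinking R S G w \<gamma> t n) = PhiR R S G w \<gamma> t"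
proof (intro equalityI subsetI)
  fix x assume "x \<in> (\<Inter>n. shrinking R S G w \<gamma> t n)"
  then have "S (G x) w \<le> ennreal (\<gamma> + inverse (real (Suc n)))"
    "R x \<le> ennreal (t + inverse (real (Suc n)))" for n
    using assms by (simp_all add: shrinking_def mem_PhiR)
  then show "x \<in> PhiR R S G w \<gamma> t"
    using assms by (simp add: mem_PhiR le_ennreal_seqI)
next
  fix x assume *: "x \<in> PhiR R S G w \<gamma> t"
  have "ennreal s \<le> ennreal (s + inverse (real (Suc n)))" for s n
    by (intro ennreal_leI) simp
  with * show "x \<in> (\<Inter>n. shrinking R S G w \<gamma> t n)"
    using assms by (auto simp: shrinking_def mem_PhiR intro: order_trans)
qed

lemma decseq_shrinking: "decseq (shrinking R S G w \<gamma> t)"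
proof (intro decseq_SucI subsetI)
  fix n x assume "x \<in> shrinking R S G w \<gamma> t (Suc n)"
  moreover have "inverse (real (Suc (Suc n))) \<le> inverse (real (Suc n))"
    by simp
  ultimately show "x \<in> shrinking R S G w \<gamma> t n"
    \<comment> \<open>The comparison is made in \<open>ereal\<close>, since no sign of
      \<open>\<gamma>\<close> or \<open>t\<close> is assumed and \<open>mem_PhiR\<close> requires
      one.\<close>
    unfolding shrinking_def PhiR_def Phi_def
    by (auto elim!: order_trans)
qed

text \<open>Cantor's intersection theorem, applied in the compact subspace \<open>K\<close>, where
  the \<open>C n\<close> are still closed.\<close>

lemma nested_compactin_nonempty:
  fixes C :: "nat \<Rightarrow> 'a set"
  assumes "compactin \<tau> K" "\<And>n. closedin \<tau> (C n)" "\<And>n. C n \<noteq> {}" "decseq C" "C 0 \<subseteq> K"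
  shows "(\<Inter>n. C n) \<noteq> {}"
proof -
  have sub: "C n \<subseteq> K" for n
    using decseqD[OF assms(4), of 0 n] assms(5) by blast
  have "compact_space (subtopology \<tau> K)"
    using assms(1) by (simp add: compact_space_subtopology)
  moreover have "closedin (subtopology \<tau> K) (C n)" for n
    using assms(2) sub by (simp add: closedin_subset_topspace)
  ultimately show ?thesis
    using assms(3,4) by (intro compact_space_imp_nest) auto
qed

text \<open>Turns approximate feasibility with arbitrarily small slack into exact feasibility. It
  serves twice: with the optimal value as level it yields minimisers, and with a smaller level it
  contradicts optimality.\<close>

lemma PhiR_nonempty_limit:
  assumes "0 \<le> \<gamma>" "0 \<le> t"
    and compact: "\<And>\<gamma> t. 0 \<le> \<gamma> \<Longrightarrow> 0 \<le> t \<Longrightarrow> compactin \<tau> (PhiR R S G w \<gamma> t)"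
    and closed: "\<And>\<gamma> t. 0 \<le> \<gamma> \<Longrightarrow> 0 \<le> t \<Longrightarrow> closedin \<tau> (PhiR R S G w \<gamma> t)"
    and nonempty: "\<And>e. 0 < e \<Longrightarrow> PhiR R S G w (\<gamma> + e) (t + e) \<noteq> {}"
  shows "PhiR R S G w \<gamma> t \<noteq> {}"
proof -
  have "(\<Inter>n. shrinking R S G w \<gamma> t n) \<noteq> {}"
  proof (rule nested_compactin_nonempty)
    show "compactin \<tau> (shrinking R S G w \<gamma> t 0)"
      using assms(1,2) by (simp add: shrinking_def compact)
    show "closedin \<tau> (shrinking R S G w \<gamma> t n)" for n
      using assms(1,2) by (simp add: shrinking_def closed)
    show "shrinking R S G w \<gamma> t n \<noteq> {}" for n
      unfolding shrinking_def by (rule nonempty) simp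
  qed (simp_all add: decseq_shrinking)
  then show ?thesis
    unfolding Inter_shrinking[OF assms(1,2)] .
qed

lemma Sol_nonempty:
  assumes "0 \<le> \<gamma>"
    and compact: "\<And>\<gamma> t. 0 \<le> \<gamma> \<Longrightarrow> 0 \<le> t \<Longrightarrow> compactin \<tau> (PhiR R S G w \<gamma> t)"
    and closed: "\<And>\<gamma> t. 0 \<le> \<gamma> \<Longrightarrow> 0 \<le> t \<Longrightarrow> closedin \<tau> (PhiR R S G w \<gamma> t)"
    and finite: "val R S G w \<gamma> < \<infinity>"
  shows "Sol R S G w \<gamma> \<noteq> {}"
proof -
  obtain r where r: "0 \<le> r" "val R S G w \<gamma> = ennreal r"
    using finite by (cases "val R S G w \<gamma>") auto
  have "PhiR R S G w \<gamma> r \<noteq> {}"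
  proof (rule PhiR_nonempty_limit[OF \<open>0 \<le> \<gamma>\<close> r(1) compact closed])
    fix e :: real assume "0 < e"
    then have "val R S G w \<gamma> < ennreal (r + e)"
      using r by (simp add: ennreal_less_iff)
    then obtain x where "x \<in> Phi S G w \<gamma>" "R x < ennreal (r + e)"
      unfolding val_def by (auto simp: INF_less_iff)
    \<comment> \<open>The near-minimiser satisfies the original constraint; it is weakened only to
      match the jointly relaxed sets.\<close>
    moreover from this have "x \<in> Phi S G w (\<gamma> + e)"
      using \<open>0 < e\<close> by (auto simp: Phi_def elim!: order_trans)
    ultimately have "x \<in> PhiR R S G w (\<gamma> + e) (r + e)"
      using \<open>0 < e\<close> r(1)
      by (simp add: PhiR_def enn2ereal_le_ereal_iff less_imp_le del: plus_ereal.simps ennreal_plus)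
    then show "PhiR R S G w (\<gamma> + e) (r + e) \<noteq> {}"
      by auto
  qed
  then show ?thesis
    using PhiR_val_eq_Sol[OF r(2) \<open>0 \<le> \<gamma>\<close> r(1)] by simp
qed

section \<open>Transfer of the constraint from perturbed to exact data\<close>

text \<open>The bound on \<open>R x\<close> is there because \<open>Fk\<close> converges uniformly
  only on sublevel sets of \<open>R\<close>.\<close>

lemma eventually_Phi_subset:
  assumes "0 \<le> \<beta>" "\<And>k. 0 \<le> \<beta>k k" and \<beta>: "\<beta>k \<longlonglongrightarrow> \<beta>"
    and y: "S_uniform_conv S yk y" and F: "loc_S_uniform_conv R S Fk F"
    and "0 \<le> t" "0 < e"
  shows "\<forall>\<^sub>F k in sequentially. \<forall>x\<in>Phi S (Fk k) (yk k) (\<beta>k k).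
           R x \<le> ennreal t \<longrightarrow> x \<in> Phi S F y (\<beta> + e)"
proof -
  \<comment> \<open>One third each for the errors in the bound, in the data and in the
    operator.\<close>
  define d where "d = e / 3"
  have "0 < d" "0 < ennreal d"
    using \<open>0 < e\<close> by (simp_all add: d_def)
  have "\<forall>\<^sub>F k in sequentially. \<beta>k k < \<beta> + d"
    using \<beta> \<open>0 < d\<close> by (intro order_tendstoD) auto
  moreover have "\<forall>\<^sub>F k in sequentially. (SUP z. absdiff (S z (yk k)) (S z y)) < ennreal d"
    using y \<open>0 < ennreal d\<close> unfolding S_uniform_conv_def by (intro order_tendstoD)
  moreover have "\<forall>\<^sub>F k in sequentially.
      Sup {absdiff (S (Fk k x) z) (S (F x) z) | x z. enn2ereal (R x) \<le> ereal t} < ennreal d"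
    using F \<open>0 \<le> t\<close> \<open>0 < ennreal d\<close> unfolding loc_S_uniform_conv_def by (intro order_tendstoD) auto
  ultimately show ?thesis
  proof eventually_elim
    case (elim k)
    show ?case
    proof (intro ballI impI)
      fix x assume x: "x \<in> Phi S (Fk k) (yk k) (\<beta>k k)" "R x \<le> ennreal t"
      \<comment> \<open>Both suprema over \<open>z\<close> are used at moving points: here
        \<open>z\<close> is \<open>F x\<close>, below it is \<open>yk k\<close>.\<close>
      have "absdiff (S (F x) (yk k)) (S (F x) y) \<le> ennreal d"
        using elim(2) by (meson SUP_lessD UNIV_I less_imp_le)
      then have "S (F x) y \<le> S (F x) (yk k) + ennreal d"
        using le_add_absdiff by (meson add_left_mono order_trans)
      moreover have "absdiff (S (Fk k x) (yk k)) (S (F x) (yk k)) \<le> ennreal d"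
        using x(2) \<open>0 \<le> t\<close>
        by (intro order_trans[OF Sup_upper less_imp_le[OF elim(3)]])
          (auto simp: enn2ereal_le_ereal_iff)
      then have "S (F x) (yk k) \<le> S (Fk k x) (yk k) + ennreal d"
        using le_add_absdiff by (meson add_left_mono order_trans)
      moreover have "S (Fk k x) (yk k) \<le> ennreal (\<beta> + d)"
        using x(1) assms(2) elim(1) by (simp add: mem_Phi) (meson ennreal_leI less_imp_le order_trans)
      ultimately have "S (F x) y \<le> ennreal (\<beta> + d) + ennreal d + ennreal d"
        by (meson add_right_mono order_trans)
      also have "\<dots> = ennreal (\<beta> + e)"
        using \<open>0 < d\<close> \<open>0 \<le> \<beta>\<close> by (simp add: d_def flip: ennreal_plus)
      finally show "x \<in> Phi S F y (\<beta> + e)"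
        using \<open>0 < e\<close> \<open>0 \<le> \<beta>\<close> by (simp add: mem_Phi)
    qed
  qed
qed

section \<open>The topology \<open>tauR\<close> and limits of sets\<close>

text \<open>Both kinds of generators have the form of a \<tau>-open set cut with an open condition
  on \<open>R\<close>, and this form survives finite intersections. Thus closeness in \<tau>
  together with closeness of the \<open>R\<close>-values gives closeness in
  \<open>tauR\<close>.\<close>

lemma openin_tauR_base:
  assumes "openin (tauR \<tau> R) V" "x \<in> V"
  shows "\<exists>U W. openin \<tau> U \<and> open W \<and> x \<in> U \<and> R x \<in> W \<and> U \<inter> R -` W \<subseteq> V"
proof -
  have "generate_topology_on
    ({U \<inter> {x. ereal s < enn2ereal (R x)} | U s. openin \<tau> U} \<union>
     {U \<inter> {x. enn2ereal (R x) < t} | U (t::ereal). openin \<tau> U \<and> t \<noteq> -\<infinity>}) V"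
    using assms(1) by (simp add: tauR_def openin_topology_generated_by_iff)
  then show ?thesis
    using \<open>x \<in> V\<close>
  proof (induction arbitrary: x)
    case (Int a b)
    from Int.IH(1)[of x] Int.prems obtain U W where
      "openin \<tau> U" "open W" "x \<in> U" "R x \<in> W" "U \<inter> R -` W \<subseteq> a"
      by blast
    moreover from Int.IH(2)[of x] Int.prems obtain U' W' where
      "openin \<tau> U'" "open W'" "x \<in> U'" "R x \<in> W'" "U' \<inter> R -` W' \<subseteq> b"
      by blast
    ultimately show ?case
      by (intro exI[of _ "U \<inter> U'"] exI[of _ "W \<inter> W'"]) auto
  next
    case (UN K)
    then obtain k where k: "k \<in> K" "x \<in> k"
      by blast
    from UN.IH[OF this] show ?case
      using k(1) by blast
  next
    case (Basis V)
    from Basis(1) show ?case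
    proof (elim UnE CollectE exE conjE)
      fix U s assume *: "V = U \<inter> {x. ereal s < enn2ereal (R x)}" "openin \<tau> U"
      have "open {r. ereal s < enn2ereal r}"
        by (intro open_Collect_less continuous_on_const continuous_on_enn2ereal)
      with * Basis(2) show ?thesis
        by (intro exI[of _ U] exI[of _ "{r. ereal s < enn2ereal r}"]) auto
    next
      fix U t assume *: "V = U \<inter> {x. enn2ereal (R x) < t}" "openin \<tau> U"
      have "open {r. enn2ereal r < t}"
        by (intro open_Collect_less continuous_on_const continuous_on_enn2ereal)
      with * Basis(2) show ?thesis
        by (intro exI[of _ U] exI[of _ "{r. enn2ereal r < t}"]) auto
    qed
  qed simp
qed

lemma openin_tauR: "openin \<tau> U \<Longrightarrow> openin (tauR \<tau> R) U"
proof -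
  assume "openin \<tau> U"
  \<comment> \<open>As \<open>R\<close> is nonnegative, the threshold -1 imposes no condition, and
    \<open>U\<close> itself is a generator.\<close>
  moreover have "{x. ereal (- 1) < enn2ereal (R x)} = UNIV"
    using enn2ereal_nonneg by (auto intro: less_le_trans[of _ 0])
  ultimately have "U \<in> {U \<inter> {x. ereal s < enn2ereal (R x)} | U s. openin \<tau> U}"
    by blast
  then show ?thesis
    unfolding tauR_def by (intro topology_generated_by_Basis) blast
qed

lemma topspace_tauR: "topspace \<tau> = UNIV \<Longrightarrow> topspace (tauR \<tau> R) = UNIV"
  using openin_subset[OF openin_tauR[OF openin_topspace[of \<tau>], of R]] by auto

text \<open>The cluster point form of the upper limit; \<open>frequently\<close> can then be
  combined with \<open>eventually\<close> statements.\<close>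

lemma mem_upper_limit_iff:
  assumes "topspace \<sigma> = UNIV"
  shows "x \<in> upper_limit \<sigma> A \<longleftrightarrow>
    (\<forall>U. openin \<sigma> U \<longrightarrow> x \<in> U \<longrightarrow> (\<exists>\<^sub>F k in sequentially. U \<inter> A k \<noteq> {}))"
proof -
  have "(\<exists>z. z \<in> (\<Union>k'\<in>{k..}. A k') \<and> z \<in> U) \<longleftrightarrow> (\<exists>k'\<ge>k. U \<inter> A k' \<noteq> {})" for k U
    by auto
  then show ?thesis
    by (auto simp: upper_limit_def in_closure_of assms frequently_sequentially)
qed

text \<open>The topological core, stated for abstract sets so that it also applies to subsequences.
  Closedness of the \<open>P n\<close> locates the cluster points, compactness produces one.\<close>

lemma upper_limit_tauR:
  fixes A P :: "nat \<Rightarrow> 'x set"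
  assumes top: "topspace \<tau> = UNIV"
    and closed: "\<And>n. closedin \<tau> (P n)" and compact: "\<And>n. compactin \<tau> (P n)"
    and nonempty: "\<And>k. A k \<noteq> {}"
    and sub: "\<And>n. \<forall>\<^sub>F k in sequentially. A k \<subseteq> P n"
    and R_A: "\<And>k x. x \<in> A k \<Longrightarrow> R x = vk k" and v: "vk \<longlonglongrightarrow> v"
    and R_P: "\<And>x. x \<in> (\<Inter>n. P n) \<Longrightarrow> R x = v"
  shows "upper_limit (tauR \<tau> R) A \<noteq> {}" "upper_limit (tauR \<tau> R) A \<subseteq> (\<Inter>n. P n)"
proof -
  have \<tau>_sub: "upper_limit \<tau> A \<subseteq> (\<Inter>n. P n)"
  proof (intro subsetI INT_I)
    fix x n assume "x \<in> upper_limit \<tau> A"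
    obtain m where "\<And>k. m \<le> k \<Longrightarrow> A k \<subseteq> P n"
      using sub by (auto simp: eventually_sequentially)
    then have "(\<Union>k\<in>{m..}. A k) \<subseteq> P n"
      by auto
    then have "\<tau> closure_of (\<Union>k\<in>{m..}. A k) \<subseteq> P n"
      using closed by (rule closure_of_minimal)
    then show "x \<in> P n"
      using \<open>x \<in> upper_limit \<tau> A\<close> by (auto simp: upper_limit_def)
  qed
  have "upper_limit (tauR \<tau> R) A \<subseteq> upper_limit \<tau> A"
    using openin_tauR[of \<tau> _ R] by (auto simp: mem_upper_limit_iff top topspace_tauR)
  with \<tau>_sub show "upper_limit (tauR \<tau> R) A \<subseteq> (\<Inter>n. P n)"
    by blast
  have "upper_limit \<tau> A \<noteq> {}"
  proof -
    obtain m where m: "\<And>k. m \<le> k \<Longrightarrow> A k \<subseteq> P 0"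
      using sub[of 0] by (auto simp: eventually_sequentially)
    \<comment> \<open>The tails start at \<open>m\<close>, because only from there on are they known
      to lie in the compact set \<open>P 0\<close>.\<close>
    define C where "C j = \<tau> closure_of (\<Union>k\<in>{m + j..}. A k)" for j
    have "(\<Inter>j. C j) \<noteq> {}"
    proof (rule nested_compactin_nonempty)
      show "compactin \<tau> (P 0)" "\<And>j. closedin \<tau> (C j)"
        by (simp_all add: compact C_def)
      show "C j \<noteq> {}" for j
        using nonempty[of "m + j"] closure_of_subset[of "\<Union>k\<in>{m + j..}. A k" \<tau>]
        by (auto simp: C_def top)
      show "decseq C"
        unfolding C_def by (intro decseq_SucI closure_of_mono UN_mono) auto
      show "C 0 \<subseteq> P 0"
        unfolding C_def using m by (intro closure_of_minimal closed) auto
    qed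
    moreover have "C j \<subseteq> \<tau> closure_of (\<Union>k\<in>{j..}. A k)" for j
      unfolding C_def by (intro closure_of_mono UN_mono) auto
    ultimately show ?thesis
      unfolding upper_limit_def by blast
  qed
  then obtain x where x: "x \<in> upper_limit \<tau> A"
    by blast
  then have "R x = v"
    using \<tau>_sub R_P by blast
  have "x \<in> upper_limit (tauR \<tau> R) A"
    unfolding mem_upper_limit_iff[OF topspace_tauR[OF top]]
  proof (intro allI impI)
    fix V assume "openin (tauR \<tau> R) V" "x \<in> V"
    then obtain U W where UW: "openin \<tau> U" "open W" "x \<in> U" "R x \<in> W" "U \<inter> R -` W \<subseteq> V"
      using openin_tauR_base by metis
    \<comment> \<open>Since \<open>R\<close> equals \<open>vk k\<close> on all of
      \<open>A k\<close>, the condition \<open>W\<close> eventually holds at every point of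
      \<open>A k\<close>, and only the \<tau>-part \<open>U\<close> has to be hit.\<close>
    have "\<forall>\<^sub>F k in sequentially. vk k \<in> W"
      using v UW(2,4) \<open>R x = v\<close> by (auto dest: topological_tendstoD)
    moreover have "\<exists>\<^sub>F k in sequentially. U \<inter> A k \<noteq> {}"
      using x UW(1,3) by (simp add: mem_upper_limit_iff[OF top])
    ultimately have "\<exists>\<^sub>F k in sequentially. vk k \<in> W \<and> U \<inter> A k \<noteq> {}"
      by (rule frequently_eventually_conj[rotated])
    then show "\<exists>\<^sub>F k in sequentially. V \<inter> A k \<noteq> {}"
    proof (rule frequently_elim1)
      fix k assume "vk k \<in> W \<and> U \<inter> A k \<noteq> {}"
      then obtain z where "z \<in> U" "z \<in> A k" "R z \<in> W"
        using R_A by auto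
      with UW(5) show "V \<inter> A k \<noteq> {}"
        by auto
    qed
  qed
  then show "upper_limit (tauR \<tau> R) A \<noteq> {}"
    by blast
qed

text \<open>The lower limit lies in the upper one, so only \<open>x\<close> has to be recovered. A
  cluster point along a subsequence is one of the whole sequence, hence is \<open>x\<close>; this is
  impossible along indices whose sets avoid a neighbourhood of \<open>x\<close>.\<close>

lemma set_limit_singletonI:
  assumes top: "topspace \<sigma> = UNIV" and upper: "upper_limit \<sigma> A = {x}"
    and subseq: "\<And>r. strict_mono r \<Longrightarrow> upper_limit \<sigma> (A \<circ> r) \<noteq> {}"
  shows "set_limit \<sigma> A {x}"
proof -
  have lower: "z \<in> lower_limit \<sigma> A \<longleftrightarrow>
      (\<forall>U. openin \<sigma> U \<longrightarrow> z \<in> U \<longrightarrow> (\<forall>\<^sub>F k in sequentially. U \<inter> A k \<noteq> {}))" for z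
  proof -
    \<comment> \<open>Reduces arbitrary neighbourhoods to open ones.\<close>
    have "\<forall>\<^sub>F k in sequentially. N \<inter> A k \<noteq> {}"
      if "\<forall>\<^sub>F k in sequentially. U \<inter> A k \<noteq> {}" "U \<subseteq> N" for U N
      using that(1) by (rule eventually_mono) (use that(2) in blast)
    then show ?thesis
      unfolding lower_limit_def eventually_sequentially[symmetric] top by blast
  qed
  have "lower_limit \<sigma> A \<subseteq> upper_limit \<sigma> A"
    by (auto simp: lower mem_upper_limit_iff[OF top] eventually_frequently)
  moreover have "x \<in> lower_limit \<sigma> A"
    unfolding lower
  proof (intro allI impI, rule ccontr)
    fix U assume U: "openin \<sigma> U" "x \<in> U" "\<not> (\<forall>\<^sub>F k in sequentially. U \<inter> A k \<noteq> {})"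
    then have "infinite {k. U \<inter> A k = {}}"
      by (simp add: not_eventually frequently_cofinite flip: cofinite_eq_sequentially)
    from infinite_enumerate[OF this]
    obtain r :: "nat \<Rightarrow> nat" where r: "strict_mono r" "\<And>n. U \<inter> A (r n) = {}"
      by auto
    obtain z where z: "z \<in> upper_limit \<sigma> (A \<circ> r)"
      using subseq[OF r(1)] by blast
    have "z \<in> upper_limit \<sigma> A"
      unfolding mem_upper_limit_iff[OF top]
    proof (intro allI impI)
      fix V assume "openin \<sigma> V" "z \<in> V"
      then have "\<exists>\<^sub>F k in sequentially. V \<inter> A (r k) \<noteq> {}"
        using z by (simp add: mem_upper_limit_iff[OF top])
      then show "\<exists>\<^sub>F k in sequentially. V \<inter> A k \<noteq> {}"
        unfolding frequently_def using eventually_subseq[OF r(1)] by blast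
    qed
    then have "z = x"
      using upper by blast
    then have "\<exists>\<^sub>F k in sequentially. U \<inter> A (r k) \<noteq> {}"
      using z U(1,2) by (simp add: mem_upper_limit_iff[OF top])
    then show False
      using r(2) by simp
  qed
  ultimately show ?thesis
    using upper by (auto simp: set_limit_def)
qed

section \<open>Convergence of values and of solution sets\<close>

theorem lemma3p6:
  fixes R :: "'x \<Rightarrow> ennreal"
    and S :: "'y \<Rightarrow> 'y \<Rightarrow> ennreal"
    and \<tau> :: "'x topology"
    and \<beta> :: real and \<beta>k :: "nat \<Rightarrow> real"
    and y :: 'y and yk :: "nat \<Rightarrow> 'y"
    and F :: "'x \<Rightarrow> 'y" and Fk :: "nat \<Rightarrow> 'x \<Rightarrow> 'y"
  assumes S_zero: "\<And>a b. S a b = 0 \<longleftrightarrow> a = b"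
    and top: "topspace \<tau> = UNIV"
    and beta: "0 \<le> \<beta>" "\<And>k. 0 \<le> \<beta>k k"
    and beta_conv: "\<beta>k \<longlonglongrightarrow> \<beta>"
    and y_conv: "S_uniform_conv S yk y"
    and F_conv: "loc_S_uniform_conv R S Fk F"
    and compact_Fk: "\<And>k w \<gamma> t. 0 \<le> \<gamma> \<Longrightarrow> 0 \<le> t \<Longrightarrow> compactin \<tau> (PhiR R S (Fk k) w \<gamma> t)"
    and compact_F: "\<And>w \<gamma> t. 0 \<le> \<gamma> \<Longrightarrow> 0 \<le> t \<Longrightarrow> compactin \<tau> (PhiR R S F w \<gamma> t)"
    and closed_Fk: "\<And>k w \<gamma> t. 0 \<le> \<gamma> \<Longrightarrow> 0 \<le> t \<Longrightarrow> closedin \<tau> (PhiR R S (Fk k) w \<gamma> t)"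
    and closed_F: "\<And>w \<gamma> t. 0 \<le> \<gamma> \<Longrightarrow> 0 \<le> t \<Longrightarrow> closedin \<tau> (PhiR R S F w \<gamma> t)"
    and nonempty: "\<And>w \<gamma> k. 0 \<le> \<gamma> \<Longrightarrow>
           \<exists>t0. PhiR R S (Fk k) w \<gamma> t0 \<noteq> {} \<and> PhiR R S F w \<gamma> t0 \<noteq> {}"
    and limsup_val: "limsup (\<lambda>k. val R S (Fk k) (yk k) (\<beta>k k)) \<le> val R S F y \<beta>"
    and val_finite: "val R S F y \<beta> < \<infinity>"
  shows "upper_limit (tauR \<tau> R) (\<lambda>k. Sol R S (Fk k) (yk k) (\<beta>k k)) \<noteq> {} \<and>
         upper_limit (tauR \<tau> R) (\<lambda>k. Sol R S (Fk k) (yk k) (\<beta>k k)) \<subseteq> Sol R S F y \<beta> \<and>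
         (\<forall>x\<beta>. Sol R S F y \<beta> = {x\<beta>} \<longrightarrow>
            set_limit (tauR \<tau> R) (\<lambda>k. Sol R S (Fk k) (yk k) (\<beta>k k)) {x\<beta>})"
proof -
  define A where "A k = Sol R S (Fk k) (yk k) (\<beta>k k)" for k
  define vk where "vk k = val R S (Fk k) (yk k) (\<beta>k k)" for k
  obtain r where r: "0 \<le> r" "val R S F y \<beta> = ennreal r"
    using val_finite by (cases "val R S F y \<beta>") auto
  have A_nonempty: "A k \<noteq> {}" for k
    unfolding A_def
  proof (rule Sol_nonempty[OF beta(2) compact_Fk closed_Fk])
    \<comment> \<open>A feasible point with finite \<open>R\<close> bounds the infimum.\<close>
    obtain t x where "x \<in> PhiR R S (Fk k) (yk k) (\<beta>k k) t"
      using nonempty[OF beta(2)] by blast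
    then have "x \<in> Phi S (Fk k) (yk k) (\<beta>k k)" "R x < \<infinity>"
      by (auto simp: PhiR_def less_top[symmetric])
    then show "val R S (Fk k) (yk k) (\<beta>k k) < \<infinity>"
      using val_le by (meson le_less_trans)
  qed
  have R_A: "x \<in> Phi S (Fk k) (yk k) (\<beta>k k)" "R x = vk k" if "x \<in> A k" for k x
    using that by (auto simp: A_def Sol_def vk_def)
  note ev = eventually_Phi_subset[OF beta beta_conv y_conv F_conv]
  \<comment> \<open>The upper half of the convergence of values, directly from the limsup
    assumption.\<close>
  have vk_less: "\<forall>\<^sub>F k in sequentially. vk k < a" if "ennreal r < a" for a
    using limsup_val that r(2) unfolding vk_def by (intro Limsup_lessD) simp
  have sub: "\<forall>\<^sub>F k in sequentially. A k \<subseteq> PhiR R S F y (\<beta> + e) (r + e)" if "0 < e" for e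
  proof -
    have "\<forall>\<^sub>F k in sequentially. vk k < ennreal (r + e)"
      using r(1) that by (intro vk_less) (simp add: ennreal_less_iff del: ennreal_plus)
    moreover have "\<forall>\<^sub>F k in sequentially. \<forall>x\<in>Phi S (Fk k) (yk k) (\<beta>k k).
        R x \<le> ennreal (r + e) \<longrightarrow> x \<in> Phi S F y (\<beta> + e)"
      using r(1) that by (intro ev) auto
    ultimately show ?thesis
    proof eventually_elim
      case (elim k)
      then show ?case
        using R_A beta(1) r(1) that by (auto simp: mem_PhiR mem_Phi less_imp_le)
    qed
  qed
  have "vk \<longlonglongrightarrow> ennreal r"
  proof (rule order_tendstoI[OF _ vk_less], rule ccontr)
    fix a assume a: "a < ennreal r" "\<not> (\<forall>\<^sub>F k in sequentially. a < vk k)"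
    then have freq: "\<exists>\<^sub>F k in sequentially. vk k \<le> a"
      by (simp add: not_eventually not_less)
    obtain s where s: "0 \<le> s" "a = ennreal s"
      using a(1) by (cases a) auto
    \<comment> \<open>The lower half: a feasible point of the limit problem at the level
      \<open>s\<close> would lie below the infimum. For each slack \<open>e\<close>, a single index
      \<open>k\<close> with \<open>vk k \<le> a\<close> suffices, since any element of
      \<open>A k\<close> is a witness.\<close>
    have "PhiR R S F y \<beta> s \<noteq> {}"
    proof (rule PhiR_nonempty_limit[OF beta(1) s(1) compact_F closed_F])
      fix e :: real assume "0 < e"
      then have "\<forall>\<^sub>F k in sequentially. \<forall>x\<in>Phi S (Fk k) (yk k) (\<beta>k k).
          R x \<le> ennreal (s + e) \<longrightarrow> x \<in> Phi S F y (\<beta> + e)"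
        using s(1) by (intro ev) auto
      then obtain k where k: "\<forall>x\<in>Phi S (Fk k) (yk k) (\<beta>k k).
          R x \<le> ennreal (s + e) \<longrightarrow> x \<in> Phi S F y (\<beta> + e)" "vk k \<le> a"
        using frequently_ex[OF frequently_eventually_conj[OF freq]] by blast
      obtain x where x: "x \<in> A k"
        using A_nonempty by blast
      have "a \<le> ennreal (s + e)"
        unfolding s(2) using \<open>0 < e\<close> by (intro ennreal_leI) simp
      then have "R x \<le> ennreal (s + e)"
        using k(2) R_A[OF x] by simp
      then have "x \<in> PhiR R S F y (\<beta> + e) (s + e)"
        using k(1) R_A[OF x] beta(1) s(1) \<open>0 < e\<close> by (simp add: mem_PhiR mem_Phi)
      then show "PhiR R S F y (\<beta> + e) (s + e) \<noteq> {}"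
        by blast
    qed
    then obtain x where "x \<in> Phi S F y \<beta>" "R x \<le> a"
      using beta(1) s by (auto simp: mem_PhiR mem_Phi)
    then show False
      using val_le[of x S F y \<beta> R] a(1) r(2) by simp
  qed
  define P where "P = shrinking R S F y \<beta> r"
  have Inter_P: "(\<Inter>n. P n) = Sol R S F y \<beta>"
    using PhiR_val_eq_Sol[OF r(2) beta(1) r(1)] Inter_shrinking[OF beta(1) r(1)]
    unfolding P_def by metis
  have P: "closedin \<tau> (P n)" "compactin \<tau> (P n)" for n
    using beta(1) r(1) by (simp_all add: P_def shrinking_def closed_F compact_F)
  have A_P: "\<forall>\<^sub>F k in sequentially. A k \<subseteq> P n" for n
    unfolding P_def shrinking_def by (rule sub) simp
  have R_P: "R x = ennreal r" if "x \<in> (\<Inter>n. P n)" for x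
    using that r(2) unfolding Inter_P by (simp add: Sol_def)
  \<comment> \<open>Proved along every subsequence: the identity gives the first two claims, the
    general case feeds \<open>set_limit_singletonI\<close>.\<close>
  have limit: "upper_limit (tauR \<tau> R) (A \<circ> q) \<noteq> {}"
    "upper_limit (tauR \<tau> R) (A \<circ> q) \<subseteq> Sol R S F y \<beta>" if q: "strict_mono q" for q
  proof -
    have *: "(A \<circ> q) k \<noteq> {}" "\<And>x. x \<in> (A \<circ> q) k \<Longrightarrow> R x = (vk \<circ> q) k" for k
      using A_nonempty R_A(2) by simp_all
    have "\<forall>\<^sub>F k in sequentially. (A \<circ> q) k \<subseteq> P n" for n
      using eventually_subseq[OF q A_P] by simp
    note limit = upper_limit_tauR[where R = R and P = P and A = "A \<circ> q", OF top P *(1) this *(2)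
        LIMSEQ_subseq_LIMSEQ[OF \<open>vk \<longlonglongrightarrow> ennreal r\<close> q] R_P]
    show "upper_limit (tauR \<tau> R) (A \<circ> q) \<noteq> {}"
      by (rule limit(1))
    show "upper_limit (tauR \<tau> R) (A \<circ> q) \<subseteq> Sol R S F y \<beta>"
      using limit(2) by (simp only: Inter_P)
  qed
  have "upper_limit (tauR \<tau> R) A \<noteq> {}" "upper_limit (tauR \<tau> R) A \<subseteq> Sol R S F y \<beta>"
    using limit[OF strict_mono_id] by simp_all
  moreover from this have "set_limit (tauR \<tau> R) A {x}" if "Sol R S F y \<beta> = {x}" for x
    using that limit(1) by (intro set_limit_singletonI topspace_tauR top) auto
  ultimately show ?thesis
    unfolding A_def by blast
qed

end
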